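(* Let $P$ and $Q$ be finite connected posets on disjoint finite sets $X_1$ and $X_2$. Then $$\delta(P\searrow Q)=P\otimes Q+(P\otimes\mathbf 1+\mathbf 1\otimes P)\searrow\delta(Q),$$ where $\mathbf 1$ denotes the empty poset.
   Context: $\mathbb U_X$ is the vector space spanned by connected partial orders on the finite set $X$; $\min(P)$ is the set of minimal elements. For $P$ on $X_1$, $Q$ on $X_2$ disjoint and $v\in X_2$, $P\searrow_v Q$ is the poset on $X_1\sqcup X_2$ whose Hasse diagram is obtained from those of $P$ and $Q$ by adding an edge from $v$ up to every minimal element of $P$ (order generated by $\le_P,\le_Q$ and $v<m$ for $m\in\min P$); $P\searrow Q=\sum_{v\in X_2}P\searrow_v Q$, extended bilinearly. On tensors, $(P\otimes\mathbf 1)\searrow(A\otimes B)=(P\searrow A)\otimes B$ and $(\mathbf 1\otimes P)\searrow(A\otimes B)=A\otimes(P\searrow B)$, extended linearly. The coproduct is $\delta(P)=\frac{1}{|\min(P)|}\sum_{I\circledcirc P}P_{|I}\otimes P\setminus I$, where $P_{|I}$ is the induced subposet, $P\setminus I$ the subposet induced on the complement, $I_-=\{x\notin I:\exists y\in I,\ x\le_P y\}$, and $I\circledcirc P$ means $I_-$ is a singleton $\{w\}$ with $w\in\min(P)$ and $I$ is a connected component (in the comparability graph) of $\{x: w<_P x\}$. *)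

theory Defs
  imports Complex_Main "HOL-Library.Poly_Mapping"
begin

subsection \<open>Finite posets\<close>

text \<open>
  A poset is given by its reflexive order relation, with \<open>(x, y) \<in> P\<close> meaning \<open>x \<le> y\<close>.
  By reflexivity the underlying set is \<open>Field P\<close>, so the poset is determined by the relation
  alone, and the empty poset is the empty relation. The induced subposet on \<open>I\<close> is \<open>Restr P I\<close>.
\<close>

definition min_elems :: "'a rel \<Rightarrow> 'a set" where
  "min_elems P = {x \<in> Field P. \<forall>y. (y, x) \<in> P \<longrightarrow> y = x}"

text \<open>The relation \<open>(P \<union> P\<inverse>)\<^sup>+\<close> is reachability in the comparability graph of \<open>P\<close>.\<close>

definition components :: "'a rel \<Rightarrow> 'a set set" where
  "components P = Field P // (P \<union> P\<inverse>)\<^sup>+"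

text \<open>As usual, the empty poset does not count as connected.\<close>

definition connected_poset_on :: "'a set \<Rightarrow> 'a rel \<Rightarrow> bool" where
  "connected_poset_on X P \<longleftrightarrow>
     partial_order_on X P \<and> X \<noteq> {} \<and> (\<forall>x\<in>X. \<forall>y\<in>X. (x, y) \<in> (P \<union> P\<inverse>)\<^sup>+)"

text \<open>
  Grafting of \<open>P\<close> above the vertex \<open>v\<close> of \<open>Q\<close>. Since \<open>P\<close> and \<open>Q\<close> are reflexive,
  the transitive closure is already the reflexive order generated on the union.
\<close>

definition graft_at :: "'a rel \<Rightarrow> 'a \<Rightarrow> 'a rel \<Rightarrow> 'a rel" where
  "graft_at P v Q = (P \<union> Q \<union> {v} \<times> min_elems P)\<^sup>+"

definition lower :: "'a rel \<Rightarrow> 'a set \<Rightarrow> 'a set" where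
  "lower P I = {x \<in> Field P - I. \<exists>y\<in>I. (x, y) \<in> P}"

definition circled :: "'a set \<Rightarrow> 'a rel \<Rightarrow> bool" where
  "circled I P \<longleftrightarrow>
     (\<exists>w\<in>min_elems P. lower P I = {w} \<and> I \<in> components (Restr P {x. (w, x) \<in> P \<and> x \<noteq> w}))"

subsection \<open>Free vector spaces and their tensor products\<close>

text \<open>
  \<open>'b \<Rightarrow>\<^sub>0 'k\<close> is the free vector space on the basis \<open>'b\<close>. The space of posets on \<open>X\<close> is the
  subspace of \<open>'a rel \<Rightarrow>\<^sub>0 'k\<close> spanned by the connected partial orders on \<open>X\<close>, and the tensor
  product of the free spaces on \<open>'b\<close> and \<open>'c\<close> is the free space on \<open>'b \<times> 'c\<close>.
\<close>

abbreviation basis :: "'b \<Rightarrow> 'b \<Rightarrow>\<^sub>0 'k::field_char_0" where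
  "basis p \<equiv> Poly_Mapping.single p 1"

definition scale :: "'k \<Rightarrow> ('b \<Rightarrow>\<^sub>0 'k) \<Rightarrow> 'b \<Rightarrow>\<^sub>0 'k::field_char_0" where
  "scale c u = Poly_Mapping.map ((*) c) u"

definition linear_ext :: "('b \<Rightarrow> 'c \<Rightarrow>\<^sub>0 'k) \<Rightarrow> ('b \<Rightarrow>\<^sub>0 'k) \<Rightarrow> 'c \<Rightarrow>\<^sub>0 'k::field_char_0" where
  "linear_ext f u = (\<Sum>p\<in>Poly_Mapping.keys u. scale (Poly_Mapping.lookup u p) (f p))"

definition bilinear_ext ::
  "('b \<Rightarrow> 'c \<Rightarrow> 'd \<Rightarrow>\<^sub>0 'k) \<Rightarrow> ('b \<Rightarrow>\<^sub>0 'k) \<Rightarrow> ('c \<Rightarrow>\<^sub>0 'k) \<Rightarrow> 'd \<Rightarrow>\<^sub>0 'k::field_char_0" where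
  "bilinear_ext f u v = linear_ext (\<lambda>p. linear_ext (f p) v) u"

definition tensor ::
  "('b \<Rightarrow>\<^sub>0 'k) \<Rightarrow> ('c \<Rightarrow>\<^sub>0 'k) \<Rightarrow> ('b \<times> 'c) \<Rightarrow>\<^sub>0 'k::field_char_0" (infixr \<open>\<otimes>\<close> 70) where
  "u \<otimes> v = bilinear_ext (\<lambda>p q. basis (p, q)) u v"

subsection \<open>Grafting and coproduct\<close>

definition graft_basis :: "'a rel \<Rightarrow> 'a rel \<Rightarrow> 'a rel \<Rightarrow>\<^sub>0 'k::field_char_0" where
  "graft_basis P Q = (\<Sum>v\<in>Field Q. basis (graft_at P v Q))"

definition graft :: "('a rel \<Rightarrow>\<^sub>0 'k) \<Rightarrow> ('a rel \<Rightarrow>\<^sub>0 'k) \<Rightarrow> 'a rel \<Rightarrow>\<^sub>0 'k::field_char_0" where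
  "graft = bilinear_ext graft_basis"

definition unit_poset :: "'a rel \<Rightarrow>\<^sub>0 'k::field_char_0" where
  "unit_poset = basis {}"

text \<open>
  On tensors the grafting acts factor by factor, and a factor \<open>\<one>\<close> on the left leaves the
  corresponding factor on the right unchanged; see \<open>tensor_graft_left\<close> and \<open>tensor_graft_right\<close>.
\<close>

definition graft_basis_unit :: "'a rel \<Rightarrow> 'a rel \<Rightarrow> 'a rel \<Rightarrow>\<^sub>0 'k::field_char_0" where
  "graft_basis_unit P Q = (if P = {} then basis Q else graft_basis P Q)"

definition tensor_graft ::
  "('a rel \<times> 'a rel \<Rightarrow>\<^sub>0 'k) \<Rightarrow> ('a rel \<times> 'a rel \<Rightarrow>\<^sub>0 'k) \<Rightarrow> 'a rel \<times> 'a rel \<Rightarrow>\<^sub>0 'k::field_char_0"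
  where "tensor_graft =
    bilinear_ext (\<lambda>(P, P') (A, B). graft_basis_unit P A \<otimes> graft_basis_unit P' B)"

definition delta_basis :: "'a rel \<Rightarrow> 'a rel \<times> 'a rel \<Rightarrow>\<^sub>0 'k::field_char_0" where
  "delta_basis P =
     scale (1 / of_nat (card (min_elems P)))
       (\<Sum>I | circled I P. basis (Restr P I) \<otimes> basis (Restr P (Field P - I)))"

definition delta :: "('a rel \<Rightarrow>\<^sub>0 'k) \<Rightarrow> 'a rel \<times> 'a rel \<Rightarrow>\<^sub>0 'k::field_char_0" where
  "delta = linear_ext delta_basis"

subsection \<open>Basic properties\<close>

lemma lookup_scale [simp]: "Poly_Mapping.lookup (scale c u) k = c * Poly_Mapping.lookup u k"
  unfolding scale_def by transfer (simp add: when_def)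

lemma lookup_linear_ext:
  assumes "finite S" "Poly_Mapping.keys u \<subseteq> S"
  shows "Poly_Mapping.lookup (linear_ext f u) k =
    (\<Sum>p\<in>S. Poly_Mapping.lookup u p * Poly_Mapping.lookup (f p) k)"
proof -
  have "Poly_Mapping.lookup (linear_ext f u) k =
    (\<Sum>p\<in>Poly_Mapping.keys u. Poly_Mapping.lookup u p * Poly_Mapping.lookup (f p) k)"
    by (simp add: linear_ext_def lookup_sum)
  also have "\<dots> = (\<Sum>p\<in>S. Poly_Mapping.lookup u p * Poly_Mapping.lookup (f p) k)"
    by (rule sum.mono_neutral_left) (use assms in \<open>auto simp: in_keys_iff\<close>)
  finally show ?thesis .
qed

lemma linear_ext_basis [simp]: "linear_ext f (basis p) = f p"
  by (rule poly_mapping_eqI) (simp add: lookup_linear_ext[of "{p}"])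

lemma linear_ext_zero [simp]: "linear_ext f 0 = 0"
  by (simp add: linear_ext_def)

lemma linear_ext_add: "linear_ext f (u + v) = linear_ext f u + linear_ext f v"
proof (rule poly_mapping_eqI)
  fix k
  let ?S = "Poly_Mapping.keys u \<union> Poly_Mapping.keys v"
  have "Poly_Mapping.keys (u + v) \<subseteq> ?S" by (rule keys_add)
  then show "Poly_Mapping.lookup (linear_ext f (u + v)) k =
      Poly_Mapping.lookup (linear_ext f u + linear_ext f v) k"
    by (simp add: lookup_linear_ext[of ?S] lookup_add sum.distrib distrib_right)
qed

lemma linear_ext_sum: "linear_ext f (sum g S) = (\<Sum>x\<in>S. linear_ext f (g x))"
  by (induction S rule: infinite_finite_induct) (simp_all add: linear_ext_add)

lemma linear_ext_scale: "linear_ext f (scale c u) = scale c (linear_ext f u)"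
proof (rule poly_mapping_eqI)
  fix k
  have "Poly_Mapping.keys (scale c u) \<subseteq> Poly_Mapping.keys u" by (auto simp: in_keys_iff)
  then show "Poly_Mapping.lookup (linear_ext f (scale c u)) k =
      Poly_Mapping.lookup (scale c (linear_ext f u)) k"
    by (simp add: lookup_linear_ext[of "Poly_Mapping.keys u"] sum_distrib_left mult.assoc)
qed

lemma linear_ext_comp: "linear_ext h (linear_ext g u) = linear_ext (\<lambda>p. linear_ext h (g p)) u"
  by (simp add: linear_ext_def[of g] linear_ext_def[of "\<lambda>p. linear_ext h (g p)"]
      linear_ext_sum linear_ext_scale)

lemma linear_ext_commute:
  "linear_ext (\<lambda>q. linear_ext (\<lambda>p. f p q) u) v = linear_ext (\<lambda>p. linear_ext (\<lambda>q. f p q) v) u"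
proof (rule poly_mapping_eqI)
  fix k
  show "Poly_Mapping.lookup (linear_ext (\<lambda>q. linear_ext (\<lambda>p. f p q) u) v) k =
      Poly_Mapping.lookup (linear_ext (\<lambda>p. linear_ext (\<lambda>q. f p q) v) u) k"
    by (simp add: lookup_linear_ext[OF finite_keys subset_refl] sum_distrib_left mult_ac)
      (rule sum.swap)
qed

lemma bilinear_ext_basis [simp]: "bilinear_ext f (basis p) (basis q) = f p q"
  by (simp add: bilinear_ext_def)

lemma tensor_basis [simp]: "basis p \<otimes> basis q = basis (p, q)"
  by (simp add: tensor_def)

lemma tensor_graft_left:
  assumes "P \<noteq> {}"
  shows "tensor_graft (basis P \<otimes> unit_poset) (A \<otimes> B) = graft (basis P) A \<otimes> B"
proof -
  have "tensor_graft (basis P \<otimes> unit_poset) (A \<otimes> B) =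
      linear_ext (\<lambda>a. linear_ext (\<lambda>b. linear_ext (\<lambda>x. basis (x, b)) (graft_basis P a)) B) A"
    using assms by (simp add: tensor_graft_def bilinear_ext_def unit_poset_def tensor_def
        graft_basis_unit_def linear_ext_comp)
  also have "\<dots> = linear_ext (\<lambda>a. linear_ext (\<lambda>x. linear_ext (\<lambda>b. basis (x, b)) B) (graft_basis P a)) A"
    by (subst linear_ext_commute) simp
  also have "\<dots> = graft (basis P) A \<otimes> B"
    by (simp add: graft_def bilinear_ext_def tensor_def linear_ext_comp)
  finally show ?thesis .
qed

lemma tensor_graft_right:
  assumes "P \<noteq> {}"
  shows "tensor_graft (unit_poset \<otimes> basis P) (A \<otimes> B) = A \<otimes> graft (basis P) B"
  using assms by (simp add: tensor_graft_def graft_def bilinear_ext_def unit_poset_def tensor_def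
      graft_basis_unit_def linear_ext_comp)

end

theory Submission
  imports Defs
begin

text \<open>
  Grafting \<open>P\<close> above a vertex \<open>v\<close> of \<open>Q\<close> does not change the minimal elements, and for a
  minimal \<open>w\<close> it changes the components of \<open>{x. w < x}\<close> as follows: if \<open>w < v\<close>, then \<open>P\<close> is
  absorbed by the component that contains \<open>v\<close>; if \<open>w = v\<close>, then \<open>P\<close> becomes a new component;
  otherwise nothing happens. Hence the sets \<open>I\<close> that contribute to the coproduct of the grafting
  are the sets \<open>J\<close> that contribute to the coproduct of \<open>Q\<close>, enlarged by \<open>P\<close> if \<open>v \<in> J\<close>, together
  with \<open>P\<close> itself if \<open>v\<close> is minimal. Summing over \<open>v\<close>, the last kind contributes once for each
  minimal element of \<open>Q\<close>, which the normalising factor turns into a single \<open>P \<otimes> Q\<close>.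
\<close>

subsection \<open>Bilinear extensions\<close>

lemma scale_sum: "scale c (sum g S) = (\<Sum>x\<in>S. scale c (g x))"
  by (rule poly_mapping_eqI) (simp add: lookup_sum sum_distrib_left)

lemma scale_add: "scale c (u + v) = scale c u + scale c v"
  by (rule poly_mapping_eqI) (simp add: lookup_add distrib_left)

text \<open>Characteristic zero makes \<open>of_nat (card S)\<close> invertible. This cancels the
  normalising factor of the coproduct against equal copies of \<open>P \<otimes> Q\<close>, one per
  minimal element of \<open>Q\<close>.\<close>

lemma scale_inverse_of_nat_sum_const:
  assumes "card S \<noteq> 0"
  shows "scale (1 / of_nat (card S)) (\<Sum>x\<in>S. u) = u"
  using assms by (intro poly_mapping_eqI) (simp add: lookup_sum)

lemma bilinear_ext_add_left:
  "bilinear_ext f (u + u') v = bilinear_ext f u v + bilinear_ext f u' v"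
  by (simp add: bilinear_ext_def linear_ext_add)

text \<open>With the second argument moved to the outer extension, linearity in it is inherited from
  \<open>linear_ext\<close>.\<close>

lemma bilinear_ext_swap: "bilinear_ext f u v = linear_ext (\<lambda>q. linear_ext (\<lambda>p. f p q) u) v"
  unfolding bilinear_ext_def by (rule linear_ext_commute[symmetric])

lemma bilinear_ext_sum_right:
  "bilinear_ext f u (sum g S) = (\<Sum>x\<in>S. bilinear_ext f u (g x))"
  by (simp add: bilinear_ext_swap linear_ext_sum)

lemma bilinear_ext_scale_right:
  "bilinear_ext f u (scale c v) = scale c (bilinear_ext f u v)"
  by (simp add: bilinear_ext_swap linear_ext_scale)

lemma graft_basis_tensor_basis:
  "graft (basis P) (basis A) \<otimes> basis B = (\<Sum>v\<in>Field A. basis (graft_at P v A, B))"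
  by (simp add: graft_def graft_basis_def tensor_def bilinear_ext_def linear_ext_sum)

lemma basis_tensor_graft_basis:
  "basis A \<otimes> graft (basis P) (basis B) = (\<Sum>v\<in>Field B. basis (A, graft_at P v B))"
  by (simp add: graft_def graft_basis_def tensor_def bilinear_ext_def linear_ext_sum)

subsection \<open>Connected components\<close>

lemma sym_trancl_comparability: "sym ((S \<union> S\<inverse>)\<^sup>+)"
  by (intro sym_trancl) (auto simp: sym_def)

lemma trancl_Image_subset:
  assumes "r `` J \<subseteq> J"
  shows "r\<^sup>+ `` J \<subseteq> J"
proof -
  have "y \<in> J" if "(x, y) \<in> r\<^sup>+" "x \<in> J" for x y
    using that by (induction rule: trancl_induct) (use assms in auto)
  then show ?thesis by blast
qed

text \<open>Closedness under edges confines the class of a point of \<open>J\<close> to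
  \<open>J\<close>, and connectedness makes it fill \<open>J\<close>. Nonemptiness provides a point
  whose class is \<open>J\<close>.\<close>

lemma components_eqI:
  assumes cover: "\<Union>C = Field S"
    and nonempty: "\<And>J. J \<in> C \<Longrightarrow> J \<noteq> {}"
    and closed: "\<And>J. J \<in> C \<Longrightarrow> (S \<union> S\<inverse>) `` J \<subseteq> J"
    and conn: "\<And>J. J \<in> C \<Longrightarrow> J \<times> J \<subseteq> (S \<union> S\<inverse>)\<^sup>+"
  shows "components S = C"
proof -
  have cls: "(S \<union> S\<inverse>)\<^sup>+ `` {x} = J" if "J \<in> C" "x \<in> J" for x J
    using trancl_Image_subset[OF closed[OF that(1)]] conn[OF that(1)] that(2) by blast
  show ?thesis
  proof
    show "components S \<subseteq> C"
    proof
      fix K assume "K \<in> components S"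
      then obtain x where x: "x \<in> Field S" "K = (S \<union> S\<inverse>)\<^sup>+ `` {x}"
        unfolding components_def by (rule quotientE)
      then obtain J where "J \<in> C" "x \<in> J" using cover by blast
      then show "K \<in> C" using x(2) cls by simp
    qed
    show "C \<subseteq> components S"
    proof
      fix J assume J: "J \<in> C"
      then obtain x where x: "x \<in> J" using nonempty by blast
      then have "x \<in> Field S" using cover J by blast
      then show "J \<in> components S"
        using cls[OF J x] unfolding components_def quotient_def by blast
    qed
  qed
qed

lemma Union_components: "\<Union>(components S) = Field S"
proof
  show "\<Union>(components S) \<subseteq> Field S"
    by (auto simp: components_def quotient_def Field_def dest: tranclD2)
  show "Field S \<subseteq> \<Union>(components S)"
  proof
    fix x assume x: "x \<in> Field S"
    then obtain y where "(x, y) \<in> S \<union> S\<inverse>" by (auto simp: Field_def)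
    \<comment> \<open>\<open>S\<close> may lack reflexivity, so \<open>x\<close> is joined to itself
      by walking to a neighbour and back.\<close>
    then have "(x, x) \<in> (S \<union> S\<inverse>)\<^sup>+"
      by (meson sym_trancl_comparability r_into_trancl' symE trancl_trans)
    then show "x \<in> \<Union>(components S)"
      using x by (auto simp: components_def quotient_def)
  qed
qed

lemma component_subset: "J \<in> components S \<Longrightarrow> J \<subseteq> Field S"
  using Union_components[of S] by blast

lemma component_closed:
  assumes "J \<in> components S"
  shows "(S \<union> S\<inverse>) `` J \<subseteq> J"
proof -
  obtain x where "J = (S \<union> S\<inverse>)\<^sup>+ `` {x}"
    using assms unfolding components_def by (rule quotientE)
  then show ?thesis by (blast intro: trancl_into_trancl)
qed

lemma component_connected:
  assumes "J \<in> components S"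
  shows "J \<times> J \<subseteq> (S \<union> S\<inverse>)\<^sup>+"
proof -
  obtain x where "J = (S \<union> S\<inverse>)\<^sup>+ `` {x}"
    using assms unfolding components_def by (rule quotientE)
  then show ?thesis
    by clarsimp (meson sym_trancl_comparability symD trancl_trans)
qed

lemma component_nonempty:
  assumes "J \<in> components S"
  shows "J \<noteq> {}"
proof -
  obtain x where x: "x \<in> Field S" "J = (S \<union> S\<inverse>)\<^sup>+ `` {x}"
    using assms by (auto simp: components_def quotient_def)
  then obtain y where "(x, y) \<in> S \<union> S\<inverse>" by (auto simp: Field_def)
  then show ?thesis using x(2) by blast
qed

text \<open>No edge of either relation touches the field of the other, so each component stays
  closed in the union. It serves the case of grafting at \<open>w\<close> itself, where
  \<open>P\<close> stands beside the points of \<open>Q\<close> strictly above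
  \<open>w\<close>.\<close>

lemma components_disjoint_Un:
  fixes A B :: "'a rel"
  assumes "Field A \<inter> Field B = {}"
  shows "components (A \<union> B) = components A \<union> components B"
proof (rule components_eqI)
  show "\<Union>(components A \<union> components B) = Field (A \<union> B)"
    using Union_components[of A] Union_components[of B] by auto
next
  fix J assume "J \<in> components A \<union> components B"
  then show "J \<noteq> {}" by (metis component_nonempty UnE)
next
  fix J assume J: "J \<in> components A \<union> components B"
  have closed_other: "(S \<union> S\<inverse>) `` K = {}" if "K \<subseteq> Field R" "Field R \<inter> Field S = {}"
    for K and R S :: "'a rel"
    using that by (auto simp: Field_def)
  consider "J \<in> components A" "J \<subseteq> Field A" | "J \<in> components B" "J \<subseteq> Field B"
    using J by (metis component_subset UnE)
  then show "(A \<union> B \<union> (A \<union> B)\<inverse>) `` J \<subseteq> J"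
  proof cases
    case 1
    then show ?thesis
      using component_closed[OF 1(1)] closed_other[of J A B] assms by auto
  next
    case 2
    then show ?thesis
      using component_closed[OF 2(1)] closed_other[of J B A] assms by auto
  qed
next
  fix J assume "J \<in> components A \<union> components B"
  then have "J \<times> J \<subseteq> (A \<union> A\<inverse>)\<^sup>+ \<or> J \<times> J \<subseteq> (B \<union> B\<inverse>)\<^sup>+"
    by (metis component_connected UnE)
  moreover have "(A \<union> A\<inverse>)\<^sup>+ \<subseteq> (A \<union> B \<union> (A \<union> B)\<inverse>)\<^sup>+" "(B \<union> B\<inverse>)\<^sup>+ \<subseteq> (A \<union> B \<union> (A \<union> B)\<inverse>)\<^sup>+"
    by (rule trancl_mono_subset, blast)+
  ultimately show "J \<times> J \<subseteq> (A \<union> B \<union> (A \<union> B)\<inverse>)\<^sup>+" by blast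
qed

lemma partial_order_on_Field:
  assumes "partial_order_on X P"
  shows "Field P = X"
  using assms by (auto simp: partial_order_on_def preorder_on_def refl_on_def Field_def)

lemma components_connected_poset:
  assumes "connected_poset_on X P"
  shows "components P = {X}"
proof (rule components_eqI)
  have "Field P = X"
    using assms partial_order_on_Field by (auto simp: connected_poset_on_def)
  then show "\<Union>{X} = Field P" "\<And>J. J \<in> {X} \<Longrightarrow> (P \<union> P\<inverse>) `` J \<subseteq> J"
    by (auto simp: Field_def)
qed (use assms in \<open>auto simp: connected_poset_on_def\<close>)

text \<open>Both components of up-sets and circled subsets change under grafting in this way, so one
  total map describes both and can later reindex the sum over circled subsets.\<close>

definition absorb :: "'a set \<Rightarrow> 'a \<Rightarrow> 'a set \<Rightarrow> 'a set" where
  "absorb X v J = (if v \<in> J then J \<union> X else J)"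

text \<open>All of \<open>X\<close> is placed above \<open>v\<close> and hence falls into the
  component of \<open>v\<close>. Every point below \<open>v\<close> already lies in that component,
  so no other component gains an edge.\<close>

lemma components_graft:
  assumes P: "connected_poset_on X P" and disj: "X \<inter> Field S = {}" and v: "(v, v) \<in> S"
  shows "components (P \<union> S \<union> {x. (x, v) \<in> S} \<times> X) = absorb X v ` components S"
    (is "components ?R = _")
proof (rule components_eqI)
  have FP: "Field P = X" and "X \<noteq> {}"
    using P partial_order_on_Field by (auto simp: connected_poset_on_def)
  have vF: "v \<in> Field S" using v by (auto simp: Field_def)
  have FR: "Field ?R = X \<union> Field S"
    using FP \<open>X \<noteq> {}\<close> by (auto simp: Field_def)
  show "\<Union>(absorb X v ` components S) = Field ?R"
  proof
    show "\<Union>(absorb X v ` components S) \<subseteq> Field ?R"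
      using Union_components[of S] FR by (auto simp: absorb_def split: if_splits)
    show "Field ?R \<subseteq> \<Union>(absorb X v ` components S)"
    proof
      fix x assume "x \<in> Field ?R"
      moreover obtain K where "K \<in> components S" "v \<in> K"
        using Union_components[of S] vF by blast
      moreover have "\<exists>J\<in>components S. x \<in> J" if "x \<in> Field S"
        using Union_components[of S] that by blast
      ultimately show "x \<in> \<Union>(absorb X v ` components S)"
        using FR by (auto simp: absorb_def)
    qed
  qed
  fix I assume "I \<in> absorb X v ` components S"
  then obtain J where J: "J \<in> components S" "I = absorb X v J" by blast
  show "I \<noteq> {}" using component_nonempty[OF J(1)] J(2) by (auto simp: absorb_def)
  have JF: "J \<subseteq> Field S" using J by (simp add: component_subset)
  have PX: "P \<subseteq> X \<times> X" using FP by (auto simp: Field_def)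
  have closed: "(S \<union> S\<inverse>) `` J \<subseteq> J" by (rule component_closed[OF J(1)])
  show "(?R \<union> ?R\<inverse>) `` I \<subseteq> I"
  proof (cases "v \<in> J")
    case True
    have "x \<in> J" if "(x, v) \<in> S" for x using True that closed by blast
    moreover have "S \<inter> X \<times> UNIV = {}" "S \<inter> UNIV \<times> X = {}"
      using disj by (auto simp: Field_def)
    ultimately show ?thesis
      using True closed PX unfolding J(2) absorb_def by auto
  next
    case False
    then have "(x, v) \<notin> S" if "x \<in> J" for x using that closed by blast
    then show ?thesis
      using False closed PX JF disj unfolding J(2) absorb_def by auto
  qed
  have mono: "(S \<union> S\<inverse>)\<^sup>+ \<subseteq> (?R \<union> ?R\<inverse>)\<^sup>+"
    by (rule trancl_mono_subset) blast
  have conJ: "J \<times> J \<subseteq> (?R \<union> ?R\<inverse>)\<^sup>+"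
    using component_connected[OF J(1)] mono by (rule subset_trans)
  define E where "E = (?R \<union> ?R\<inverse>)\<^sup>+"
  have E: "sym E" "trans E"
    unfolding E_def by (rule sym_trancl_comparability, rule trans_trancl)
  have "I \<times> I \<subseteq> E"
  proof (cases "v \<in> J")
    case True
    \<comment> \<open>The vertex \<open>v\<close> acts as a hub: points of \<open>X\<close> are
      adjacent to it and points of \<open>J\<close> are connected to it, so any two points of
      \<open>I\<close> are joined through \<open>v\<close>.\<close>
    have "(v, x) \<in> E" if "x \<in> X" for x
      unfolding E_def by (rule r_into_trancl) (use that v in auto)
    then have "\<forall>x\<in>I. (v, x) \<in> E"
      using True conJ unfolding J(2) absorb_def E_def[symmetric] by auto
    then show ?thesis
      using symD[OF E(1)] transD[OF E(2)] by (meson SigmaE2 subrelI)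
  next
    case False
    then show ?thesis using J conJ by (simp add: absorb_def E_def)
  qed
  then show "I \<times> I \<subseteq> (?R \<union> ?R\<inverse>)\<^sup>+" by (simp only: E_def)
qed

subsection \<open>The grafted order\<close>

text \<open>The strict order is finite and acyclic, hence well-founded. A minimal element among
  those below \<open>x\<close> is minimal in \<open>P\<close> by transitivity.\<close>

lemma finite_poset_min_below:
  assumes "finite X" "partial_order_on X P" "x \<in> X"
  shows "\<exists>m\<in>min_elems P. (m, x) \<in> P"
proof -
  have po: "refl_on X P" "trans P" "antisym P" "P \<subseteq> X \<times> X"
    using assms(2) by (auto simp: partial_order_on_def preorder_on_def refl_on_def)
  have "wf (P - Id)"
    using po assms(1) by (intro finite_acyclic_wf acyclicI)
      (auto simp: trancl_id trans_diff_Id intro: finite_subset)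
  then obtain m where m: "m \<in> {y. (y, x) \<in> P}" "\<And>y. (y, m) \<in> P - Id \<Longrightarrow> y \<notin> {y. (y, x) \<in> P}"
    using po assms(3) wfE_min[of "P - Id" x "{y. (y, x) \<in> P}"] by (auto simp: refl_on_def)
  then have "m \<in> min_elems P"
    using po(2) by (auto simp: min_elems_def Field_def dest: transD)
  then show ?thesis using m by blast
qed

text \<open>A closed form that eliminates the transitive closure. The right side is transitive and
  contains the generators; conversely, \<open>x \<le> v\<close> and \<open>y \<in> X\<close> are
  linked by the chain \<open>x \<le> v < m \<le> y\<close> for a minimal \<open>m\<close> of
  \<open>P\<close> below \<open>y\<close>.\<close>

lemma graft_at_eq:
  assumes "finite X" and P: "partial_order_on X P" and Q: "trans Q"
    and disj: "X \<inter> Field Q = {}" and v: "(v, v) \<in> Q"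
  shows "graft_at P v Q = P \<union> Q \<union> {x. (x, v) \<in> Q} \<times> X" (is "_ = ?R")
proof
  have FP: "Field P = X" using P by (rule partial_order_on_Field)
  have tP: "trans P" using P by (auto simp: partial_order_on_def preorder_on_def)
  have "trans ?R"
  proof (rule transI)
    fix x y z assume "(x, y) \<in> ?R" "(y, z) \<in> ?R"
    then show "(x, z) \<in> ?R"
      using FP disj by (auto simp: Field_def intro: transD[OF tP] transD[OF Q])
  qed
  moreover have "P \<union> Q \<union> {v} \<times> min_elems P \<subseteq> ?R"
    using v FP by (auto simp: min_elems_def)
  ultimately show "graft_at P v Q \<subseteq> ?R"
    unfolding graft_at_def by (metis trancl_id trancl_mono subsetI)
  show "?R \<subseteq> graft_at P v Q"
  proof -
    have "(x, y) \<in> graft_at P v Q" if x: "(x, v) \<in> Q" and y: "y \<in> X" for x y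
    proof -
      obtain m where "m \<in> min_elems P" "(m, y) \<in> P"
        using finite_poset_min_below[OF assms(1) P y] by blast
      then have "(x, v) \<in> graft_at P v Q" "(v, m) \<in> graft_at P v Q" "(m, y) \<in> graft_at P v Q"
        using x by (auto simp: graft_at_def)
      then show ?thesis unfolding graft_at_def by (meson trancl_trans)
    qed
    then show ?thesis by (auto simp: graft_at_def)
  qed
qed

lemma Field_Restr_refl:
  assumes "partial_order_on X Q" "J \<subseteq> X"
  shows "Field (Restr Q J) = J"
  using assms by (auto simp: partial_order_on_def preorder_on_def refl_on_def Field_def)

lemma circled_subset:
  assumes "circled J Q"
  shows "J \<subseteq> Field Q"
proof -
  obtain w where "J \<in> components (Restr Q {x. (w, x) \<in> Q \<and> x \<noteq> w})"
    using assms by (auto simp: circled_def)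
  then have "J \<subseteq> Field (Restr Q {x. (w, x) \<in> Q \<and> x \<noteq> w})"
    by (rule component_subset)
  then show ?thesis by (auto simp: Field_def)
qed

lemma finite_circled: "finite (Field Q) \<Longrightarrow> finite {J. circled J Q}"
  by (rule finite_subset[of _ "Pow (Field Q)"]) (auto dest: circled_subset)

text \<open>Index of the basis tensor contributed by \<open>I\<close>. Keeping it as a pair of
  relations separates the comparison of posets from the linear algebra.\<close>

definition split_term :: "'a rel \<Rightarrow> 'a set \<Rightarrow> 'a rel \<times> 'a rel" where
  "split_term R I = (Restr R I, Restr R (Field R - I))"

section \<open>Order, ground set and minimal elements of the grafting\<close>

locale grafting =
  fixes P Q :: "'a rel" and X Y :: "'a set"
  assumes finite_X: "finite X" and finite_Y: "finite Y" and disjoint: "X \<inter> Y = {}"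
    and P: "connected_poset_on X P" and Q: "connected_poset_on Y Q"
begin

lemma po_P: "partial_order_on X P" and po_Q: "partial_order_on Y Q"
  using P Q by (auto simp: connected_poset_on_def)

lemma Field_P: "Field P = X" and Field_Q: "Field Q = Y"
  using po_P po_Q by (simp_all add: partial_order_on_Field)

lemma P_subset: "P \<subseteq> X \<times> X" and Q_subset: "Q \<subseteq> Y \<times> Y"
  using Field_P Field_Q by (auto simp: Field_def)

lemma X_nonempty: "X \<noteq> {}" and Y_nonempty: "Y \<noteq> {}"
  using P Q by (auto simp: connected_poset_on_def)

lemma P_nonempty: "P \<noteq> {}"
  using X_nonempty Field_P by auto

lemma refl_Q: "x \<in> Y \<Longrightarrow> (x, x) \<in> Q"
  using po_Q by (auto simp: partial_order_on_def preorder_on_def refl_on_def)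

lemma trans_Q: "trans Q"
  using po_Q by (auto simp: partial_order_on_def preorder_on_def)

lemma graft_at_Restr:
  assumes "v \<in> J" "J \<subseteq> Y"
  shows "graft_at P v (Restr Q J) = P \<union> Restr Q J \<union> {x \<in> J. (x, v) \<in> Q} \<times> X"
proof -
  have "trans (Restr Q J)" using trans_Q by (rule trans_Restr)
  moreover have "X \<inter> Field (Restr Q J) = {}"
    using assms disjoint Field_Restr_refl[OF po_Q] by blast
  ultimately show ?thesis
    using assms refl_Q graft_at_eq[OF finite_X po_P, of "Restr Q J" v] by auto
qed

lemma graft_at_Q:
  assumes "v \<in> Y"
  shows "graft_at P v Q = P \<union> Q \<union> {x. (x, v) \<in> Q} \<times> X"
  using assms graft_at_eq[OF finite_X po_P trans_Q] disjoint refl_Q Field_Q by auto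

lemma Field_graft:
  assumes "v \<in> Y"
  shows "Field (graft_at P v Q) = X \<union> Y"
  using assms Field_P Field_Q refl_Q[OF assms] by (auto simp: graft_at_Q Field_def)

text \<open>Points of \<open>X\<close> lie strictly above \<open>v\<close>, and points of
  \<open>Y\<close> gain nothing below them. Hence the normalising factor is the same for every
  \<open>v\<close>.\<close>

lemma min_elems_graft:
  assumes "v \<in> Y"
  shows "min_elems (graft_at P v Q) = min_elems Q"
proof -
  have "x \<notin> X" if "\<forall>y. (y, x) \<in> graft_at P v Q \<longrightarrow> y = x" for x
    using that disjoint assms refl_Q[OF assms] by (auto simp: graft_at_Q)
  then show ?thesis
    using disjoint assms P_subset Q_subset
    unfolding min_elems_def Field_graft[OF assms] Field_Q by (auto simp: graft_at_Q)
qed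

section \<open>Components above a minimal element of the grafting\<close>

abbreviation above :: "'a \<Rightarrow> 'a rel" where
  "above w \<equiv> Restr Q {x. (w, x) \<in> Q \<and> x \<noteq> w}"

text \<open>\<open>X\<close> lies above \<open>w\<close> exactly when \<open>w \<le> v\<close>. For
  \<open>v = w\<close>, minimality leaves only \<open>w\<close> below \<open>v\<close>, and
  \<open>w\<close> is removed, so \<open>P\<close> has no edge to the rest; for \<open>w < v\<close>
  the points between \<open>w\<close> and \<open>v\<close> remain attached to
  \<open>X\<close>.\<close>

lemma above_graft:
  assumes "v \<in> Y" "w \<in> min_elems Q"
  shows "Restr (graft_at P v Q) {x. (w, x) \<in> graft_at P v Q \<and> x \<noteq> w} =
    (if v = w then P \<union> above w
     else if (w, v) \<in> Q then P \<union> above w \<union> {x. (x, v) \<in> above w} \<times> X else above w)"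
proof -
  have w: "w \<in> Y" "w \<notin> X" "\<And>y. (y, w) \<in> Q \<Longrightarrow> y = w"
    using assms disjoint by (auto simp: min_elems_def Field_Q)
  show ?thesis
    using w P_subset Q_subset disjoint assms(1) refl_Q[OF assms(1)] refl_Q[OF w(1)]
    unfolding graft_at_Q[OF assms(1)] by auto
qed

text \<open>One formula covers all three cases: unless \<open>w < v\<close>, the vertex
  \<open>v\<close> is outside \<open>above w\<close> and \<open>absorb X v\<close> fixes every
  component.\<close>

lemma components_above_graft:
  assumes "v \<in> Y" "w \<in> min_elems Q"
  shows "components (Restr (graft_at P v Q) {x. (w, x) \<in> graft_at P v Q \<and> x \<noteq> w}) =
    absorb X v ` components (above w) \<union> (if v = w then {X} else {})"
proof -
  have disj: "X \<inter> Field (above w) = {}"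
    using disjoint Q_subset by (auto simp: Field_def)
  have keep: "absorb X v ` components (above w) = components (above w)"
    if "v \<notin> Field (above w)"
  proof -
    have "absorb X v J = J" if "J \<in> components (above w)" for J
      using \<open>v \<notin> Field (above w)\<close> component_subset[OF that] by (auto simp: absorb_def)
    then show ?thesis by simp
  qed
  consider "v = w" | "v \<noteq> w" "(w, v) \<in> Q" | "v \<noteq> w" "(w, v) \<notin> Q" by blast
  then show ?thesis
  proof cases
    case 1
    then have "v \<notin> Field (above w)" by (auto simp: Field_def)
    then show ?thesis
      using 1 disj keep components_disjoint_Un[of P "above w"] components_connected_poset[OF P]
      unfolding above_graft[OF assms] by (simp add: Field_P)
  next
    case 2
    then have "(v, v) \<in> above w" using refl_Q assms by auto
    then show ?thesis
      using 2 components_graft[OF P disj, of v] unfolding above_graft[OF assms] by simp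
  next
    case 3
    then have "v \<notin> Field (above w)" by (auto simp: Field_def)
    then show ?thesis using 3 keep unfolding above_graft[OF assms] by simp
  qed
qed

section \<open>Circled subsets of the grafting and sums over them\<close>

lemma lower_graft_absorb:
  assumes "v \<in> Y" "J \<subseteq> Y"
  shows "lower (graft_at P v Q) (absorb X v J) = lower Q J"
  \<comment> \<open>If \<open>X\<close> is absorbed, then \<open>v \<in> J\<close>, and whatever
    lies below \<open>X\<close> from outside is at most \<open>v\<close>, so it is already in
    \<open>J\<close> or below \<open>J\<close>. If it is not absorbed, \<open>J\<close> stays inside
    \<open>Y\<close>, where no point of \<open>X\<close> lies below.\<close>
  using assms P_subset Q_subset disjoint refl_Q[OF assms(1)]
  unfolding lower_def absorb_def Field_graft[OF assms(1)] Field_Q by (auto simp: graft_at_Q)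

text \<open>The points of \<open>Y\<close> below \<open>X\<close> are those at most
  \<open>v\<close>, and minimality leaves \<open>v\<close> alone.\<close>

lemma lower_graft_X:
  assumes "v \<in> min_elems Q"
  shows "lower (graft_at P v Q) X = {v}"
proof -
  have v: "v \<in> Y" "\<And>y. (y, v) \<in> Q \<Longrightarrow> y = v"
    using assms by (auto simp: min_elems_def Field_Q)
  then show ?thesis
    using P_subset Q_subset disjoint refl_Q[OF v(1)] X_nonempty
    unfolding lower_def Field_graft[OF v(1)] by (auto simp: graft_at_Q)
qed

lemma circled_graft:
  assumes "v \<in> Y"
  shows "{I. circled I (graft_at P v Q)} =
    absorb X v ` {J. circled J Q} \<union> (if v \<in> min_elems Q then {X} else {})"
proof -
  have sub: "J \<subseteq> Y" if "J \<in> components (above w)" for J w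
    using component_subset[OF that] Q_subset by (auto simp: Field_def)
  have "circled I (graft_at P v Q) \<longleftrightarrow>
      (\<exists>w\<in>min_elems Q. lower (graft_at P v Q) I = {w} \<and>
         (I \<in> absorb X v ` components (above w) \<or> v = w \<and> I = X))" for I
    unfolding circled_def min_elems_graft[OF assms]
    using components_above_graft[OF assms] by (auto split: if_splits)
  \<comment> \<open>For absorbed sets the condition on \<open>lower\<close> passes back to
    \<open>Q\<close>; for \<open>I = X\<close> it holds automatically with
    \<open>w = v\<close>.\<close>
  also have "\<dots> I \<longleftrightarrow>
      (\<exists>J. I = absorb X v J \<and> (\<exists>w\<in>min_elems Q. lower Q J = {w} \<and> J \<in> components (above w)))
       \<or> v \<in> min_elems Q \<and> I = X" for I
    using lower_graft_absorb[OF assms sub] lower_graft_X by blast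
  finally show ?thesis by (auto simp: circled_def)
qed

text \<open>Intersecting with \<open>Y\<close> recovers the original set.\<close>

lemma inj_on_absorb: "inj_on (absorb X v) (Pow Y)"
  using disjoint by (auto simp: inj_on_def absorb_def split: if_splits)

text \<open>An enlarged set contains \<open>v\<close>, which is outside \<open>X\<close>; an
  unchanged one lies in \<open>Y\<close> and cannot equal the nonempty \<open>X\<close>. So the
  extra term for \<open>X\<close> is not counted twice.\<close>

lemma X_notin_absorb: "v \<in> Y \<Longrightarrow> X \<notin> absorb X v ` {J. circled J Q}"
  using disjoint circled_subset[of _ Q] Field_Q X_nonempty
  by (fastforce simp: absorb_def split: if_splits)

lemma sum_circled_graft:
  assumes "v \<in> Y"
  shows "(\<Sum>I | circled I (graft_at P v Q). f I) =
    (\<Sum>J | circled J Q. f (absorb X v J)) + (if v \<in> min_elems Q then f X else 0)"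
proof -
  have fin: "finite {J. circled J Q}"
    using finite_circled[of Q] Field_Q finite_Y by simp
  have "inj_on (absorb X v) {J. circled J Q}"
    by (rule inj_on_subset[OF inj_on_absorb]) (use circled_subset Field_Q in auto)
  then have "sum f (absorb X v ` {J. circled J Q}) = (\<Sum>J | circled J Q. f (absorb X v J))"
    by (simp add: sum.reindex)
  then show ?thesis
    using fin X_notin_absorb[OF assms] by (simp add: circled_graft[OF assms] add.commute)
qed

section \<open>Tensor factors of the grafting and the coproduct identity\<close>

lemma split_term_graft_absorb:
  assumes "v \<in> Y" "J \<subseteq> Y"
  shows "split_term (graft_at P v Q) (absorb X v J) =
    (if v \<in> J then (graft_at P v (Restr Q J), Restr Q (Y - J))
     else (Restr Q J, graft_at P v (Restr Q (Y - J))))"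
proof (cases "v \<in> J")
  \<comment> \<open>Here \<open>X\<close> goes with \<open>v\<close> into the first factor, which
    produces the action of \<open>P \<otimes> \<one>\<close>.\<close>
  case True
  then show ?thesis
    using assms P_subset Q_subset disjoint
    unfolding split_term_def absorb_def Field_graft[OF assms(1)]
    by (auto simp: graft_at_Q graft_at_Restr)
next
  \<comment> \<open>Here \<open>X\<close> and \<open>v\<close> both stay in the complement, which
    produces the action of \<open>\<one> \<otimes> P\<close>.\<close>
  case False
  then show ?thesis
    using assms P_subset Q_subset disjoint
    unfolding split_term_def absorb_def Field_graft[OF assms(1)]
    by (auto simp: graft_at_Q graft_at_Restr)
qed

lemma split_term_graft_X:
  assumes "v \<in> Y"
  shows "split_term (graft_at P v Q) X = (P, Q)"
  using assms P_subset Q_subset disjoint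
  unfolding split_term_def Field_graft[OF assms] by (auto simp: graft_at_Q)

lemma delta_basis_graft_at:
  assumes "v \<in> Y"
  shows "delta_basis (graft_at P v Q) =
    scale (1 / of_nat (card (min_elems Q)))
      ((\<Sum>J | circled J Q. if v \<in> J then basis (graft_at P v (Restr Q J), Restr Q (Y - J))
           else basis (Restr Q J, graft_at P v (Restr Q (Y - J))))
       + (if v \<in> min_elems Q then basis (P, Q) else 0))"
proof -
  have "delta_basis (graft_at P v Q) =
      scale (1 / of_nat (card (min_elems Q)))
        (\<Sum>I | circled I (graft_at P v Q). basis (split_term (graft_at P v Q) I))"
    by (simp add: delta_basis_def split_term_def min_elems_graft[OF assms])
  also have "(\<Sum>I | circled I (graft_at P v Q). basis (split_term (graft_at P v Q) I)) =
      (\<Sum>J | circled J Q. basis (split_term (graft_at P v Q) (absorb X v J)))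
       + (if v \<in> min_elems Q then basis (P, Q) else 0)"
    by (simp add: sum_circled_graft[OF assms] split_term_graft_X[OF assms])
  also have "(\<Sum>J | circled J Q. basis (split_term (graft_at P v Q) (absorb X v J))) =
      (\<Sum>J | circled J Q. if v \<in> J then basis (graft_at P v (Restr Q J), Restr Q (Y - J))
           else basis (Restr Q J, graft_at P v (Restr Q (Y - J))))"
    using circled_subset[of _ Q] Field_Q
    by (intro sum.cong) (auto simp: split_term_graft_absorb[OF assms])
  finally show ?thesis .
qed

text \<open>The two factors of a summand have fields \<open>J\<close> and \<open>Y - J\<close>.
  Grafting on either factor therefore gives complementary sums over \<open>v\<close>, ready to be
  merged into one sum over \<open>Y\<close>.\<close>

lemma tensor_graft_delta:
  "(tensor_graft (basis P \<otimes> unit_poset + unit_poset \<otimes> basis P) (delta (basis Q))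
      :: 'a rel \<times> 'a rel \<Rightarrow>\<^sub>0 'k::field_char_0) =
    scale (1 / of_nat (card (min_elems Q)))
      (\<Sum>J | circled J Q. (\<Sum>v\<in>J. basis (graft_at P v (Restr Q J), Restr Q (Y - J)))
         + (\<Sum>v\<in>Y - J. basis (Restr Q J, graft_at P v (Restr Q (Y - J)))))"
proof -
  let ?u = "basis P \<otimes> unit_poset + unit_poset \<otimes> basis P :: 'a rel \<times> 'a rel \<Rightarrow>\<^sub>0 'k"
  have "tensor_graft ?u (basis (Restr Q J) \<otimes> basis (Restr Q (Y - J))) =
      (\<Sum>v\<in>J. basis (graft_at P v (Restr Q J), Restr Q (Y - J)))
         + (\<Sum>v\<in>Y - J. basis (Restr Q J, graft_at P v (Restr Q (Y - J))))"
    if "circled J Q" for J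
  proof -
    have J: "J \<subseteq> Y" using circled_subset[OF that] Field_Q by simp
    have "tensor_graft ?u (basis (Restr Q J) \<otimes> basis (Restr Q (Y - J))) =
      tensor_graft (basis P \<otimes> unit_poset) (basis (Restr Q J) \<otimes> basis (Restr Q (Y - J))) +
      tensor_graft (unit_poset \<otimes> basis P) (basis (Restr Q J) \<otimes> basis (Restr Q (Y - J)))"
      by (simp only: tensor_graft_def bilinear_ext_add_left)
    then show ?thesis
      using Field_Restr_refl[OF po_Q J] Field_Restr_refl[OF po_Q, of "Y - J"]
      by (simp only: tensor_graft_left[OF P_nonempty] tensor_graft_right[OF P_nonempty]
          graft_basis_tensor_basis basis_tensor_graft_basis) simp
  qed
  then have "(\<Sum>J | circled J Q. tensor_graft ?u (basis (Restr Q J) \<otimes> basis (Restr Q (Y - J)))) =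
      (\<Sum>J | circled J Q. (\<Sum>v\<in>J. basis (graft_at P v (Restr Q J), Restr Q (Y - J)))
         + (\<Sum>v\<in>Y - J. basis (Restr Q J, graft_at P v (Restr Q (Y - J)))))"
    by (intro sum.cong) auto
  then show ?thesis
    unfolding delta_def linear_ext_basis delta_basis_def Field_Q
    by (simp only: tensor_graft_def bilinear_ext_sum_right bilinear_ext_scale_right)
qed

lemma card_min_elems_Q: "card (min_elems Q) \<noteq> 0"
proof -
  obtain y where "y \<in> Y" using Y_nonempty by blast
  then have "min_elems Q \<noteq> {}" using finite_poset_min_below[OF finite_Y po_Q] by blast
  moreover have "min_elems Q \<subseteq> Y" by (auto simp: min_elems_def Field_Q)
  ultimately show ?thesis using finite_Y by (auto simp: card_eq_0_iff dest: finite_subset)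
qed

lemma delta_graft:
  "(delta (graft (basis P) (basis Q)) :: 'a rel \<times> 'a rel \<Rightarrow>\<^sub>0 'k::field_char_0) =
    basis P \<otimes> basis Q +
    tensor_graft (basis P \<otimes> unit_poset + unit_poset \<otimes> basis P) (delta (basis Q))"
proof -
  let ?c = "1 / of_nat (card (min_elems Q)) :: 'k"
  let ?l = "\<lambda>J v. basis (graft_at P v (Restr Q J), Restr Q (Y - J)) :: _ \<Rightarrow>\<^sub>0 'k"
  let ?r = "\<lambda>J v. basis (Restr Q J, graft_at P v (Restr Q (Y - J))) :: _ \<Rightarrow>\<^sub>0 'k"
  \<comment> \<open>For a fixed circled subset, the position of \<open>v\<close> decides which
    tensor factor is grafted.\<close>
  have split: "(\<Sum>v\<in>Y. if v \<in> J then ?l J v else ?r J v) = sum (?l J) J + sum (?r J) (Y - J)"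
    if "circled J Q" for J
  proof -
    have "J \<subseteq> Y" using circled_subset[OF that] Field_Q by simp
    then show ?thesis
      using finite_Y by (simp add: sum.If_cases Int_absorb1 Diff_eq)
  qed
  have mins: "(\<Sum>v\<in>Y. if v \<in> min_elems Q then basis (P, Q) else 0) =
      (\<Sum>v\<in>min_elems Q. basis (P, Q) :: _ \<Rightarrow>\<^sub>0 'k)"
    using finite_Y by (intro sum.mono_neutral_cong_right) (auto simp: min_elems_def Field_Q)
  have "(delta (graft (basis P) (basis Q)) :: _ \<Rightarrow>\<^sub>0 'k) = (\<Sum>v\<in>Y. delta_basis (graft_at P v Q))"
    by (simp add: delta_def graft_def graft_basis_def linear_ext_sum Field_Q)
  also have "\<dots> = scale ?c
      ((\<Sum>v\<in>Y. \<Sum>J | circled J Q. if v \<in> J then ?l J v else ?r J v)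
       + (\<Sum>v\<in>Y. if v \<in> min_elems Q then basis (P, Q) else 0))"
    by (simp add: delta_basis_graft_at scale_sum[symmetric] sum.distrib)
  \<comment> \<open>The range of \<open>J\<close> is the set of circled subsets of \<open>Q\<close>,
    independent of \<open>v\<close>, so the sums can be exchanged.\<close>
  also have "(\<Sum>v\<in>Y. \<Sum>J | circled J Q. if v \<in> J then ?l J v else ?r J v) =
      (\<Sum>J | circled J Q. sum (?l J) J + sum (?r J) (Y - J))"
    by (subst sum.swap) (simp add: split)
  finally show ?thesis
    unfolding mins scale_add scale_inverse_of_nat_sum_const[OF card_min_elems_Q] tensor_graft_delta
    by (simp add: add.commute)
qed

end

theorem theorem3p11:
  fixes P Q :: "'a rel" and X1 X2 :: "'a set"
  assumes "finite X1" and "finite X2" and "X1 \<inter> X2 = {}"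
    and "connected_poset_on X1 P" and "connected_poset_on X2 Q"
  shows "(delta (graft (basis P) (basis Q)) :: 'a rel \<times> 'a rel \<Rightarrow>\<^sub>0 'k::field_char_0) =
    basis P \<otimes> basis Q +
    tensor_graft (basis P \<otimes> unit_poset + unit_poset \<otimes> basis P) (delta (basis Q))"
proof -
  interpret grafting P Q X1 X2
    using assms by unfold_locales
  show ?thesis by (rule delta_graft)
qed

end
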